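(* Let $n\ge 2$ and $k\ge 1$ be integers. Then $$\operatorname{tdepth}\big(\boldsymbol{n}^k\setminus\{\boldsymbol{0}\}\big)=\operatorname{tdepth}\llbracket \underbrace{n-1,n-1,\dots,n-1}_{k}\rrbracket=(n-1)\lceil k/2\rceil.$$
   Context: $\boldsymbol{n}$ denotes the $n$-element chain $0<1<\cdots<n-1$, $\boldsymbol{n}^k$ the direct product of $k$ copies of it (ordered componentwise), and $\boldsymbol{0}=(0,\dots,0)$ its bottom element. For positive integers $n_1,\dots,n_k$, $\llbracket n_1,\dots,n_k\rrbracket$ denotes the poset of nonempty submultisets of the multiset $\{1^{n_1},\dots,k^{n_k}\}$ ordered by inclusion; equivalently, the set of nonzero tuples $(a_1,\dots,a_k)$ of integers with $0\le a_j\le n_j$ for all $j$, ordered componentwise. An interval in a finite poset $P$ is a set $[X,Y]=\{Z\in P: X\le Z\le Y\}$ with $X\le Y$ in $P$; $Y$ is its top element. An interval partition of $P$ is a partition of $P$ into nonempty pairwise disjoint intervals. The height of $Z\in P$ is the maximal size $m$ of a chain $Z=Z_1>Z_2>\cdots>Z_m$ in $P$ (in $\llbracket n_1,\dots,n_k\rrbracket$ the height of $(z_1,\dots,z_k)$ is $z_1+\cdots+z_k$). The total depth of an interval partition $\pi$ is $\operatorname{tdepth}\pi=\min_{[X,Y]\in\pi}\operatorname{height}Y$, and the total depth of $P$ is $\operatorname{tdepth}P=\max_\pi\operatorname{tdepth}\pi$ over all interval partitions $\pi$ of $P$. *)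

theory Defs
  imports Complex_Main "HOL-Library.FuncSet" "HOL-Library.Multiset" "HOL-Library.Disjoint_Sets"
begin

text \<open>
  A finite poset is given by a finite carrier \<open>P\<close> and a relation \<open>le\<close> that is a partial order
  on \<open>P\<close>. For such posets, the sets under \<open>Max\<close> in \<open>height\<close> and under \<open>Min\<close> and \<open>Max\<close>
  below are finite, and for nonempty \<open>P\<close> (and \<open>Z \<in> P\<close>) they are also nonempty.
\<close>

definition interval_in :: "'a set \<Rightarrow> ('a \<Rightarrow> 'a \<Rightarrow> bool) \<Rightarrow> 'a \<Rightarrow> 'a \<Rightarrow> 'a set" where
  "interval_in P le X Y = {Z \<in> P. le X Z \<and> le Z Y}"

definition interval_partition :: "'a set \<Rightarrow> ('a \<Rightarrow> 'a \<Rightarrow> bool) \<Rightarrow> 'a set set \<Rightarrow> bool" where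
  "interval_partition P le \<pi> \<longleftrightarrow>
     partition_on P \<pi> \<and> (\<forall>I\<in>\<pi>. \<exists>X\<in>P. \<exists>Y\<in>P. le X Y \<and> I = interval_in P le X Y)"

text \<open>The lists below are the chains \<open>Z = Z\<^sub>1 > Z\<^sub>2 > \<dots> > Z\<^sub>m\<close> in \<open>P\<close>; height counts elements.\<close>

definition height :: "'a set \<Rightarrow> ('a \<Rightarrow> 'a \<Rightarrow> bool) \<Rightarrow> 'a \<Rightarrow> nat" where
  "height P le Z = Max {length zs | zs.
     zs \<noteq> [] \<and> hd zs = Z \<and> set zs \<subseteq> P \<and> sorted_wrt (\<lambda>x y. le y x \<and> y \<noteq> x) zs}"

definition tdepth_partition ::
  "'a set \<Rightarrow> ('a \<Rightarrow> 'a \<Rightarrow> bool) \<Rightarrow> 'a set set \<Rightarrow> nat" where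
  "tdepth_partition P le \<pi> = Min {height P le Y | X Y.
     X \<in> P \<and> Y \<in> P \<and> le X Y \<and> interval_in P le X Y \<in> \<pi>}"

definition tdepth :: "'a set \<Rightarrow> ('a \<Rightarrow> 'a \<Rightarrow> bool) \<Rightarrow> nat" where
  "tdepth P le = Max {tdepth_partition P le \<pi> | \<pi>. interval_partition P le \<pi>}"

text \<open>
  Elements of the power \<open>n\<^sup>k\<close> of the \<open>n\<close>-element chain are functions on \<open>{1..k}\<close>, made
  extensional (\<open>undefined\<close> outside \<open>{1..k}\<close>) so that equality is equality of \<open>k\<close>-tuples.
\<close>

definition chain_power :: "nat \<Rightarrow> nat \<Rightarrow> (nat \<Rightarrow> nat) set" where
  "chain_power n k = (\<Pi>\<^sub>E j\<in>{1..k}. {0..<n})"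

definition tuple_le :: "nat \<Rightarrow> (nat \<Rightarrow> nat) \<Rightarrow> (nat \<Rightarrow> nat) \<Rightarrow> bool" where
  "tuple_le k x y \<longleftrightarrow> (\<forall>j\<in>{1..k}. x j \<le> y j)"

definition zero_tuple :: "nat \<Rightarrow> nat \<Rightarrow> nat" where
  "zero_tuple k = (\<lambda>j\<in>{1..k}. 0)"

text \<open>
  The poset of nonempty submultisets of \<open>{1^(m 1), \<dots>, k^(m k)}\<close>. It is ordered by inclusion
  \<open>\<subseteq>#\<close>, which differs from the order \<open>\<le>\<close> of the \<open>order\<close> class instance on multisets.
\<close>

definition nonempty_submultisets :: "nat \<Rightarrow> (nat \<Rightarrow> nat) \<Rightarrow> nat multiset set" where
  "nonempty_submultisets k m =
     {A. A \<noteq> {#} \<and> A \<subseteq># (\<Sum>j\<in>{1..k}. replicate_mset (m j) j)}"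

end

theory Submission
  imports Defs
begin

text \<open>
  Write \<open>m = n - 1\<close>. Among the nonzero tuples the height of a tuple is the sum of its entries
  (\<open>height_nonzero_tuples\<close>), so a tuple whose support has \<open>s\<close> elements has height at most \<open>m * s\<close>,
  and the claim is about how large the supports of the top elements can be kept.

  Upper bound (\<open>top_of_small_height_exists\<close>). In an interval partition every atom \<open>e\<^sub>i\<close> is the
  bottom of its interval \<open>[e\<^sub>i, Y\<^sub>i]\<close>. For \<open>i \<noteq> j\<close> it is impossible that both \<open>j\<close> lies in the
  support of \<open>Y\<^sub>i\<close> and \<open>i\<close> in the support of \<open>Y\<^sub>j\<close>, since then \<open>e\<^sub>i + e\<^sub>j\<close> would lie in two intervals.
  So at most one ordered pair out of each \<open>{(i, j), (j, i)}\<close> is used, and by averaging some \<open>Y\<^sub>i\<close>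
  has a support of at most \<open>(k + 1) / 2\<close> elements.

  Lower bound (\<open>tdepth_nonzero_tuples\<close>). An interval \<open>[A, B]\<close> of sets gives the interval of all
  tuples whose support lies between \<open>A\<close> and \<open>B\<close>; its top is \<open>m\<close> times the indicator of \<open>B\<close>. Hence
  it suffices to partition the nonempty subsets of \<open>{1..k}\<close> into intervals \<open>[A, B]\<close> with
  \<open>2 * card B \<ge> k\<close>. Consider the tournament on the natural numbers in which \<open>x\<close> beats \<open>y\<close> iff
  either \<open>x > y\<close> and \<open>x + y\<close> is even, or \<open>x < y\<close> and \<open>x + y\<close> is odd. Read as a zero-sum game
  on a finite set \<open>S\<close> of moves, it has exactly one uniform equilibrium with strictly losing moves
  outside its support: a set \<open>A \<subseteq> S\<close>, the kernel of \<open>S\<close>, that balances wins and losses against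
  each of its own elements and wins on balance against every other element of \<open>S\<close>
  (\<open>kernel_exists\<close>, \<open>kernel_unique\<close>). Whether \<open>A\<close> is the kernel of \<open>S\<close> is decided element by
  element, so the sets with kernel \<open>A\<close> form the interval from \<open>A\<close> to \<open>A\<close> together with all moves
  that lose against \<open>A\<close> (\<open>kernel_iff_between\<close>), and existence and uniqueness of kernels say that
  these intervals partition the nonempty sets. That the tops are large (\<open>card_kernel_top\<close>)
  reflects the cyclic symmetry of the tournament: along a gap of \<open>A\<close>, winning and losing against
  \<open>A\<close> alternate.
\<close>

section \<open>Heights and total depth in finite posets\<close>

text \<open>
  A chain cannot be longer than the rank of its largest element because ranks drop strictly and
  stay positive; descending one rank at a time builds a chain that is exactly that long.
\<close>

lemma height_eq_rank:
  fixes r :: "'a \<Rightarrow> nat"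
  assumes mono: "\<And>x y. \<lbrakk>x \<in> P; y \<in> P; le y x; y \<noteq> x\<rbrakk> \<Longrightarrow> r y < r x"
    and pos: "\<And>x. x \<in> P \<Longrightarrow> 0 < r x"
    and down: "\<And>x. \<lbrakk>x \<in> P; 1 < r x\<rbrakk> \<Longrightarrow> \<exists>y\<in>P. le y x \<and> y \<noteq> x \<and> Suc (r y) = r x"
    and trans: "\<And>x y z. \<lbrakk>x \<in> P; y \<in> P; z \<in> P; le x y; le y z\<rbrakk> \<Longrightarrow> le x z"
    and Z: "Z \<in> P"
  shows "height P le Z = r Z"
proof -
  let ?R = "\<lambda>x y. le y x \<and> y \<noteq> x"
  let ?chain = "\<lambda>Z zs. zs \<noteq> [] \<and> hd zs = Z \<and> set zs \<subseteq> P \<and> sorted_wrt ?R zs"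
  have upper: "length zs \<le> r z" if "?chain z zs" for z zs
    using that
  proof (induction zs arbitrary: z)
    case Nil
    then show ?case by simp
  next
    case (Cons a zs)
    show ?case
    proof (cases "zs = []")
      case True
      then show ?thesis using Cons.prems pos[of a] by (auto simp: Suc_le_eq)
    next
      case False
      then have "length zs \<le> r (hd zs)" using Cons by auto
      moreover have "r (hd zs) < r a"
        using mono[of a "hd zs"] False Cons.prems by (auto dest: hd_in_set)
      ultimately show ?thesis using Cons.prems by simp
    qed
  qed
  have lower: "\<exists>zs. ?chain z zs \<and> length zs = r z" if "z \<in> P" for z
    using that
  proof (induction "r z" arbitrary: z rule: less_induct)
    case less
    show ?case
    proof (cases "1 < r z")
      case False
      then have "r z = 1" using pos[OF less.prems] by simp
      then show ?thesis using less.prems by (intro exI[of _ "[z]"]) simp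
    next
      case True
      then obtain y where y: "y \<in> P" "le y z" "y \<noteq> z" "Suc (r y) = r z"
        using down less.prems by blast
      then obtain zs where zs: "?chain y zs" "length zs = r y"
        using less.hyps[of y] by auto
      have "?R z x" if "x \<in> set zs" for x
      proof (cases "x = y")
        case True
        then show ?thesis using y by simp
      next
        case False
        then have "le x y" using zs(1) that by (cases zs) auto
        moreover have "x \<in> P" using zs(1) that by auto
        ultimately show ?thesis
          using trans[of x y z] mono[of y x] y less.prems False by auto
      qed
      then show ?thesis
        using zs y(4) less.prems by (intro exI[of _ "z # zs"]) auto
    qed
  qed
  define C where "C = {zs. ?chain Z zs}"
  have "{length zs |zs. ?chain Z zs} = length ` C"
    unfolding C_def by (rule setcompr_eq_image)
  moreover have le: "l \<le> r Z" if "l \<in> length ` C" for l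
  proof -
    from that obtain zs where "zs \<in> C" "l = length zs" by blast
    then show ?thesis using upper[of zs Z] by (simp add: C_def)
  qed
  moreover have "r Z \<in> length ` C"
  proof -
    obtain zs where "?chain Z zs" "length zs = r Z" using lower[OF Z] by blast
    then show ?thesis by (intro image_eqI[of _ _ zs]) (simp_all add: C_def)
  qed
  moreover have "finite (length ` C)"
    by (rule finite_subset[of _ "{..r Z}"]) (use le in blast)+
  ultimately show ?thesis
    unfolding height_def by (simp only: Max_eqI)
qed

lemma tdepth_eqI:
  assumes fin: "finite P"
    and part: "interval_partition P le \<pi>0"
    and deep: "\<And>X Y. \<lbrakk>X \<in> P; Y \<in> P; le X Y; interval_in P le X Y \<in> \<pi>0\<rbrakk> \<Longrightarrow> h \<le> height P le Y"
    and shallow: "\<And>\<pi>. interval_partition P le \<pi> \<Longrightarrow>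
      \<exists>X\<in>P. \<exists>Y\<in>P. le X Y \<and> interval_in P le X Y \<in> \<pi> \<and> height P le Y \<le> h"
  shows "tdepth P le = h"
proof -
  let ?H = "\<lambda>\<pi>. {height P le Y | X Y. X \<in> P \<and> Y \<in> P \<and> le X Y \<and> interval_in P le X Y \<in> \<pi>}"
  have finH: "finite (?H \<pi>)" for \<pi>
    by (rule finite_subset[of _ "height P le ` P"]) (use fin in auto)
  have le: "tdepth_partition P le \<pi> \<le> h" if "interval_partition P le \<pi>" for \<pi>
  proof -
    from shallow[OF that] obtain X Y where Y: "height P le Y \<le> h"
      and "X \<in> P" "Y \<in> P" "le X Y" "interval_in P le X Y \<in> \<pi>" by blast
    then have "height P le Y \<in> ?H \<pi>" by blast
    then have "tdepth_partition P le \<pi> \<le> height P le Y"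
      unfolding tdepth_partition_def by (rule Min_le[OF finH])
    then show ?thesis using Y by simp
  qed
  have "?H \<pi>0 \<noteq> {}" using shallow[OF part] by blast
  then have "h \<le> tdepth_partition P le \<pi>0"
    unfolding tdepth_partition_def using finH[of \<pi>0] deep by (subst Min_ge_iff) auto
  then have eq: "tdepth_partition P le \<pi>0 = h" using le[OF part] by simp
  have "{\<pi>. interval_partition P le \<pi>} \<subseteq> Pow (Pow P)"
    by (auto simp: interval_partition_def partition_on_def)
  then have "finite {\<pi>. interval_partition P le \<pi>}"
    by (rule finite_subset) (use fin in simp)
  then have "finite {tdepth_partition P le \<pi> |\<pi>. interval_partition P le \<pi>}" by simp
  then show ?thesis
    unfolding tdepth_def using le part eq by (intro Max_eqI) auto
qed

text \<open>
  Intervals are recorded by their pairs of endpoints, so that a partition is a family of pairs such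
  that each element lies between the endpoints of exactly one of them.
\<close>

lemma interval_partitionI:
  assumes ref: "\<And>x. x \<in> P \<Longrightarrow> le x x"
    and ends: "\<And>X Y. (X, Y) \<in> E \<Longrightarrow> X \<in> P \<and> Y \<in> P \<and> le X Y"
    and cover: "\<And>Z. Z \<in> P \<Longrightarrow> \<exists>X Y. (X, Y) \<in> E \<and> le X Z \<and> le Z Y"
    and unique: "\<And>Z X Y X' Y'. \<lbrakk>Z \<in> P; (X, Y) \<in> E; le X Z; le Z Y; (X', Y') \<in> E; le X' Z; le Z Y'\<rbrakk>
      \<Longrightarrow> X = X' \<and> Y = Y'"
  shows "interval_partition P le ((\<lambda>(X, Y). interval_in P le X Y) ` E)"
proof -
  let ?\<pi> = "(\<lambda>(X, Y). interval_in P le X Y) ` E"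
  have ends': "\<exists>X Y. (X, Y) \<in> E \<and> I = interval_in P le X Y" if "I \<in> ?\<pi>" for I
    using that by auto
  have "partition_on P ?\<pi>"
  proof (rule partition_onI)
    show "\<Union> ?\<pi> = P"
    proof
      show "\<Union> ?\<pi> \<subseteq> P" by (auto simp: interval_in_def)
      show "P \<subseteq> \<Union> ?\<pi>"
      proof
        fix Z assume "Z \<in> P"
        with cover obtain X Y where "(X, Y) \<in> E" "Z \<in> interval_in P le X Y"
          unfolding interval_in_def by blast
        then show "Z \<in> \<Union> ?\<pi>" by blast
      qed
    qed
  next
    fix I J assume I: "I \<in> ?\<pi>" and J: "J \<in> ?\<pi>" and "I \<noteq> J"
    obtain X Y where XY: "(X, Y) \<in> E" "I = interval_in P le X Y" using ends'[OF I] by blast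
    obtain X' Y' where XY': "(X', Y') \<in> E" "J = interval_in P le X' Y'" using ends'[OF J] by blast
    show "disjnt I J"
      unfolding disjnt_def
    proof (rule equals0I)
      fix Z assume "Z \<in> I \<inter> J"
      then have "X = X' \<and> Y = Y'"
        using unique[OF _ XY(1) _ _ XY'(1)] unfolding XY(2) XY'(2) interval_in_def by blast
      then show False using XY(2) XY'(2) \<open>I \<noteq> J\<close> by simp
    qed
  next
    show "{} \<notin> ?\<pi>"
    proof
      assume "{} \<in> ?\<pi>"
      then obtain X Y where XY: "(X, Y) \<in> E" "{} = interval_in P le X Y" using ends' by blast
      have "X \<in> interval_in P le X Y" using ends[OF XY(1)] ref by (simp add: interval_in_def)
      then show False using XY(2) by simp
    qed
  qed
  moreover have "\<exists>X\<in>P. \<exists>Y\<in>P. le X Y \<and> I = interval_in P le X Y" if "I \<in> ?\<pi>" for I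
    using ends'[OF that] ends by blast
  ultimately show ?thesis by (simp add: interval_partition_def)
qed

definition order_iso where
  "order_iso f P le Q le' \<longleftrightarrow> bij_betw f P Q \<and> (\<forall>x\<in>P. \<forall>y\<in>P. le' (f x) (f y) \<longleftrightarrow> le x y)"

lemma order_iso_inv:
  assumes "order_iso f P le Q le'"
  shows "order_iso (inv_into P f) Q le' P le"
proof -
  have bij: "bij_betw f P Q" using assms by (simp add: order_iso_def)
  have "le (inv_into P f x) (inv_into P f y) \<longleftrightarrow> le' x y" if "x \<in> Q" "y \<in> Q" for x y
    using assms that bij_betw_inv_into_right[OF bij] bij_betwE[OF bij_betw_inv_into[OF bij]]
    unfolding order_iso_def by metis
  then show ?thesis using bij_betw_inv_into[OF bij] by (simp add: order_iso_def)
qed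

text \<open>
  Only one inclusion is stated: the other one is this lemma for the inverse isomorphism.
\<close>

lemma chain_lengths_order_iso:
  assumes iso: "order_iso f P le Q le'"
  shows "{length zs | zs. zs \<noteq> [] \<and> hd zs = Z \<and> set zs \<subseteq> P \<and> sorted_wrt (\<lambda>x y. le y x \<and> y \<noteq> x) zs}
    \<subseteq> {length zs | zs. zs \<noteq> [] \<and> hd zs = f Z \<and> set zs \<subseteq> Q \<and> sorted_wrt (\<lambda>x y. le' y x \<and> y \<noteq> x) zs}"
proof clarify
  fix zs assume zs: "zs \<noteq> []" "set zs \<subseteq> P" "sorted_wrt (\<lambda>x y. le y x \<and> y \<noteq> x) zs"
  have inj: "inj_on f P" and img: "f ` P = Q"
    using iso by (auto simp: order_iso_def bij_betw_def)
  have "sorted_wrt (\<lambda>x y. le' (f y) (f x) \<and> f y \<noteq> f x) zs"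
    using zs(3)
  proof (rule sorted_wrt_mono_rel[rotated])
    fix x y assume xy: "x \<in> set zs" "y \<in> set zs" and less: "le y x \<and> y \<noteq> x"
    then have P: "x \<in> P" "y \<in> P" using zs(2) by blast+
    then have "le' (f y) (f x)" using iso less by (simp add: order_iso_def)
    moreover have "f y \<noteq> f x" using inj_onD[OF inj _ P(2) P(1)] less by blast
    ultimately show "le' (f y) (f x) \<and> f y \<noteq> f x" by blast
  qed
  then show "\<exists>ys. length zs = length ys \<and> ys \<noteq> [] \<and> hd ys = f (hd zs) \<and> set ys \<subseteq> Q \<and>
      sorted_wrt (\<lambda>x y. le' y x \<and> y \<noteq> x) ys"
    using zs img by (intro exI[of _ "map f zs"]) (auto simp: hd_map sorted_wrt_map)
qed

lemma height_order_iso: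
  assumes iso: "order_iso f P le Q le'" and Z: "Z \<in> P"
  shows "height Q le' (f Z) = height P le Z"
proof -
  have inv: "inv_into P f (f Z) = Z"
    using iso bij_betw_inv_into_left[OF _ Z] unfolding order_iso_def by blast
  show ?thesis
    unfolding height_def
    using chain_lengths_order_iso[OF iso, of Z]
      chain_lengths_order_iso[OF order_iso_inv[OF iso], of "f Z", unfolded inv]
    by (intro arg_cong[of _ _ Max] subset_antisym)
qed

lemma interval_in_order_iso:
  assumes "order_iso f P le Q le'" "X \<in> P" "Y \<in> P"
  shows "interval_in Q le' (f X) (f Y) = f ` interval_in P le X Y"
  using assms by (auto simp: order_iso_def interval_in_def bij_betw_def)

lemma interval_partition_order_iso:
  assumes iso: "order_iso f P le Q le'" and part: "interval_partition P le \<pi>"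
  shows "interval_partition Q le' ((`) f ` \<pi>)"
    and "tdepth_partition Q le' ((`) f ` \<pi>) = tdepth_partition P le \<pi>"
proof -
  have inj: "inj_on f P" and img: "f ` P = Q"
    using iso by (auto simp: order_iso_def bij_betw_def)
  have le: "le' (f X) (f Y) \<longleftrightarrow> le X Y" if "X \<in> P" "Y \<in> P" for X Y
    using iso that by (simp add: order_iso_def)
  have on: "partition_on P \<pi>" using part by (simp add: interval_partition_def)
  have "(`) f ` \<pi> - {{}} = (`) f ` \<pi>"
    using partition_onD3[OF on] by auto
  then have "partition_on Q ((`) f ` \<pi>)"
    using partition_on_inj_image[OF on inj] img by simp
  moreover have "\<exists>X\<in>Q. \<exists>Y\<in>Q. le' X Y \<and> I = interval_in Q le' X Y" if I: "I \<in> (`) f ` \<pi>" for I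
  proof -
    obtain J where J: "J \<in> \<pi>" "I = f ` J" using I by auto
    then obtain X Y where "X \<in> P" "Y \<in> P" "le X Y" "J = interval_in P le X Y"
      using part by (auto simp: interval_partition_def)
    then show ?thesis
      using J le interval_in_order_iso[OF iso] img
      by (intro bexI[of _ "f X"] bexI[of _ "f Y"]) auto
  qed
  ultimately show "interval_partition Q le' ((`) f ` \<pi>)"
    by (simp add: interval_partition_def)
  have mem: "interval_in Q le' (f X) (f Y) \<in> (`) f ` \<pi> \<longleftrightarrow> interval_in P le X Y \<in> \<pi>"
    if "X \<in> P" "Y \<in> P" for X Y
  proof -
    have "inj_on ((`) f) (Pow P)" using inj by (rule inj_on_image_Pow)
    moreover have "\<pi> \<subseteq> Pow P" using on by (auto simp: partition_on_def)
    moreover have "interval_in P le X Y \<in> Pow P" by (auto simp: interval_in_def)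
    ultimately show ?thesis
      unfolding interval_in_order_iso[OF iso that] by (intro inj_on_image_mem_iff)
  qed
  have "{height Q le' Y | X Y. X \<in> Q \<and> Y \<in> Q \<and> le' X Y \<and> interval_in Q le' X Y \<in> (`) f ` \<pi>}
    = {height P le Y | X Y. X \<in> P \<and> Y \<in> P \<and> le X Y \<and> interval_in P le X Y \<in> \<pi>}" (is "?L = ?R")
  proof
    show "?L \<subseteq> ?R"
    proof
      fix h assume "h \<in> ?L"
      then obtain X' Y' where *: "h = height Q le' Y'" "X' \<in> Q" "Y' \<in> Q" "le' X' Y'"
        "interval_in Q le' X' Y' \<in> (`) f ` \<pi>" by blast
      obtain X Y where XY: "X \<in> P" "Y \<in> P" "X' = f X" "Y' = f Y" using *(2,3) img by blast
      have "h = height P le Y" "le X Y" "interval_in P le X Y \<in> \<pi>"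
        using * unfolding XY(3,4) by (simp_all add: mem le height_order_iso[OF iso] XY(1,2))
      then show "h \<in> ?R" using XY(1,2) by blast
    qed
    show "?R \<subseteq> ?L"
    proof
      fix h assume "h \<in> ?R"
      then obtain X Y where *: "h = height P le Y" "X \<in> P" "Y \<in> P" "le X Y"
        "interval_in P le X Y \<in> \<pi>" by blast
      then have "h = height Q le' (f Y)" "f X \<in> Q" "f Y \<in> Q" "le' (f X) (f Y)"
        "interval_in Q le' (f X) (f Y) \<in> (`) f ` \<pi>"
        using mem le height_order_iso[OF iso] img by auto
      then show "h \<in> ?L" by blast
    qed
  qed
  then show "tdepth_partition Q le' ((`) f ` \<pi>) = tdepth_partition P le \<pi>"
    by (simp add: tdepth_partition_def)
qed

lemma tdepth_order_iso:
  assumes iso: "order_iso f P le Q le'"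
  shows "tdepth Q le' = tdepth P le"
proof -
  have sub: "{tdepth_partition P le \<pi> |\<pi>. interval_partition P le \<pi>}
    \<subseteq> {tdepth_partition Q le' \<pi> |\<pi>. interval_partition Q le' \<pi>}"
    if "order_iso f P le Q le'" for f :: "'c \<Rightarrow> 'd" and P le Q le'
    proof clarify
    fix \<pi> assume "interval_partition P le \<pi>"
    then show "\<exists>\<pi>'. tdepth_partition P le \<pi> = tdepth_partition Q le' \<pi>' \<and> interval_partition Q le' \<pi>'"
      using interval_partition_order_iso[OF that] by metis
  qed
  show ?thesis
    unfolding tdepth_def
    using sub[OF iso] sub[OF order_iso_inv[OF iso]] by (intro arg_cong[of _ _ Max] subset_antisym)
qed

section \<open>A partition of the nonempty subsets into deep intervals\<close>

text \<open>
  The summand is \<open>1\<close> if \<open>a\<close> beats \<open>x\<close> in the tournament, \<open>-1\<close> if \<open>x\<close> beats \<open>a\<close>, and \<open>0\<close> for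
  \<open>a = x\<close>. Thus the score is the payoff of the uniform strategy on \<open>A\<close> against the move \<open>x\<close>,
  scaled by the size of \<open>A\<close>. On \<open>{1..k}\<close> with \<open>k\<close> odd the tournament is the rotational one, where
  each point of a circle beats the half circle behind it: walking along the circle visits the even
  numbers in order and then the odd numbers in order.
\<close>

definition score :: "nat set \<Rightarrow> nat \<Rightarrow> int" where
  "score A x = (\<Sum>a\<in>A. sgn (int a - int x) * (-1) ^ (a + x))"

definition kernel :: "nat set \<Rightarrow> nat set \<Rightarrow> bool" where
  "kernel A S \<longleftrightarrow> A \<subseteq> S \<and> (\<forall>x\<in>A. score A x = 0) \<and> (\<forall>x\<in>S - A. 0 < score A x)"

text \<open>The game is zero-sum.\<close>

lemma score_skew: "(\<Sum>b\<in>B. score A b) = - (\<Sum>a\<in>A. score B a)"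
proof -
  have "(\<Sum>b\<in>B. score A b) = (\<Sum>a\<in>A. \<Sum>b\<in>B. sgn (int a - int b) * (-1) ^ (a + b))"
    unfolding score_def by (rule sum.swap)
  also have "\<dots> = (\<Sum>a\<in>A. \<Sum>b\<in>B. - (sgn (int b - int a) * (-1) ^ (b + a)))"
    by (intro sum.cong refl) (auto simp: sgn_if add.commute)
  finally show ?thesis by (simp add: score_def sum_negf)
qed

text \<open>
  If \<open>A\<close> and \<open>B\<close> are kernels of \<open>S\<close>, then \<open>A\<close> loses on balance against no element of \<open>B\<close>, and
  wins against the elements of \<open>B - A\<close>; the same holds with the roles exchanged. As the two total
  payoffs add up to zero, both differences are empty.
\<close>

lemma kernel_unique:
  assumes "finite S" "kernel A S" "kernel B S"
  shows "A = B"
proof -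
  have fin: "finite A" "finite B"
    using assms finite_subset by (auto simp: kernel_def)
  have nonneg: "0 \<le> (\<Sum>b\<in>B. score A b)" "B - A \<noteq> {} \<Longrightarrow> 0 < (\<Sum>b\<in>B. score A b)"
    if A: "kernel A S" and B: "kernel B S" and "finite B" for A B
  proof -
    have ge: "0 \<le> score A b" if "b \<in> B" for b
      using A B that by (cases "b \<in> A") (force simp: kernel_def)+
    then show "0 \<le> (\<Sum>b\<in>B. score A b)" by (rule sum_nonneg)
    assume "B - A \<noteq> {}"
    then obtain b where b: "b \<in> B" "b \<notin> A" by blast
    then have "0 < score A b" using A B by (auto simp: kernel_def)
    then show "0 < (\<Sum>b\<in>B. score A b)" using b ge \<open>finite B\<close> by (intro sum_pos2[of B b]) auto
  qed
  have "B - A = {}" "A - B = {}"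
    using nonneg[OF assms(2,3) fin(2)] nonneg[OF assms(3,2) fin(1)] score_skew[of A B] by force+
  then show ?thesis by blast
qed

text \<open>
  With the factor \<open>(-1) ^ x\<close> the score becomes a signed count of the elements of \<open>A\<close> above \<open>x\<close>
  minus one of the elements below, which is constant along a gap of \<open>A\<close>; it can only change by the
  contributions of the endpoints of the gap. The next lemma does the same for the remaining gap,
  the one that leads from the largest element around to the smallest, where above and below
  trade places and the count changes its sign.
\<close>

lemma score_step:
  assumes fin: "finite A" and "x < y" and gap: "\<forall>a\<in>A. a \<le> x \<or> y \<le> a"
  shows "(-1) ^ y * score A y = (-1) ^ x * score A x
    - (if x \<in> A then (-1) ^ x else 0) - (if y \<in> A then (-1) ^ y else 0)"
proof -
  have pow: "(-1) ^ z * (sgn (int a - int z) * (-1) ^ (a + z)) = sgn (int a - int z) * (-1 :: int) ^ a"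
    for a z by (simp add: power_add)
  have "(-1) ^ y * score A y = (\<Sum>a\<in>A. sgn (int a - int y) * (-1) ^ a)"
    unfolding score_def sum_distrib_left pow ..
  also have "\<dots> = (\<Sum>a\<in>A. sgn (int a - int x) * (-1) ^ a
      - (if x = a then (-1) ^ a else 0) - (if y = a then (-1) ^ a else 0))"
    using gap \<open>x < y\<close> by (intro sum.cong refl) (force simp: sgn_if)
  also have "\<dots> = (-1) ^ x * score A x
      - (\<Sum>a\<in>A. if x = a then (-1) ^ a else 0) - (\<Sum>a\<in>A. if y = a then (-1) ^ a else 0)"
    unfolding score_def sum_distrib_left pow sum_subtractf ..
  also have "\<dots> = (-1) ^ x * score A x
    - (if x \<in> A then (-1) ^ x else 0) - (if y \<in> A then (-1) ^ y else 0)"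
    using fin by (simp add: sum.delta)
  finally show ?thesis .
qed

lemma score_wrap:
  assumes fin: "finite A" and "w \<le> z" and within: "A \<subseteq> {w..z}"
  shows "(-1) ^ z * score A z = - ((-1) ^ w * score A w)
    - (if w \<in> A then (-1) ^ w else 0) + (if z \<in> A then (-1) ^ z else 0)"
proof -
  have pow: "(-1) ^ z * (sgn (int a - int z) * (-1) ^ (a + z)) = sgn (int a - int z) * (-1 :: int) ^ a"
    for a z by (simp add: power_add)
  have "(-1) ^ z * score A z = (\<Sum>a\<in>A. sgn (int a - int z) * (-1) ^ a)"
    unfolding score_def sum_distrib_left pow ..
  also have "\<dots> = (\<Sum>a\<in>A. - (sgn (int a - int w) * (-1) ^ a)
      - (if w = a then (-1) ^ a else 0) + (if z = a then (-1) ^ a else 0))"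
    using within by (intro sum.cong refl) (force simp: sgn_if)
  also have "\<dots> = - ((-1) ^ w * score A w)
      - (\<Sum>a\<in>A. if w = a then (-1) ^ a else 0) + (\<Sum>a\<in>A. if z = a then (-1) ^ a else 0)"
    unfolding score_def sum_distrib_left pow sum_subtractf sum.distrib sum_negf ..
  also have "\<dots> = - ((-1) ^ w * score A w)
    - (if w \<in> A then (-1) ^ w else 0) + (if z \<in> A then (-1) ^ z else 0)"
    using fin by (simp add: sum.delta)
  finally show ?thesis .
qed

lemma predecessor_exists:
  fixes S :: "nat set"
  assumes "finite S" "w \<in> S" "w < x"
  obtains y where "y \<in> S" "y < x" "\<forall>a\<in>S. a \<le> y \<or> x \<le> a"
proof -
  let ?T = "{a \<in> S. a < x}"
  have T: "finite ?T" "?T \<noteq> {}" using assms by auto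
  then have "Max ?T \<in> ?T" by (rule Max_in)
  moreover have "a \<le> Max ?T \<or> x \<le> a" if "a \<in> S" for a
    using T(1) that by (cases "a < x") auto
  ultimately show ?thesis using that by blast
qed

text \<open>
  The score condition holds whenever \<open>y\<close> beats \<open>x\<close> and all other elements of \<open>A\<close> fare alike
  against \<open>x\<close> and against \<open>y\<close>. Then \<open>A\<close> wins against \<open>x\<close>: if \<open>y \<in> A\<close> then from the
  extra point, and otherwise because \<open>A\<close> already wins against \<open>y\<close>.
\<close>

lemma kernel_insert_dominated:
  assumes A: "kernel A (S - {x})" and y: "y \<in> S" "y \<noteq> x"
    and dom: "score A x = score A y + (if y \<in> A then 1 else 0)"
  shows "kernel A S"
proof -
  have "0 < score A x"
    using A y dom by (cases "y \<in> A") (auto simp: kernel_def)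
  then show ?thesis using A by (auto simp: kernel_def)
qed

text \<open>
  Arrange \<open>S\<close> in increasing order and close it up to a cycle. Neighbours \<open>x < y\<close> of equal parity
  fare alike against all others, and so do the largest and the smallest element if their parities
  differ; in each of these situations one of the two dominates the other, which can be removed
  without changing the kernel. When no such pair is left, the parities alternate along \<open>S\<close> and its
  two ends have equal parity. Then the signed score is constant along \<open>S\<close>, and closing the
  cycle shows that it equals its own negative, so that \<open>S\<close> is its own kernel.
\<close>

lemma kernel_exists:
  assumes "finite S"
  shows "\<exists>A. kernel A S"
  using assms
proof (induction S rule: finite_psubset_induct)
  case (psubset S)
  have remove: "\<exists>A. kernel A (S - {x})" if "x \<in> S" for x
    using psubset.IH[of "S - {x}"] that by blast
  have finA: "finite A" if "kernel A (S - {x})" for A x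
    using that \<open>finite S\<close> by (meson finite_Diff finite_subset kernel_def)
  consider (empty) "S = {}"
    | (same) x y where "x \<in> S" "y \<in> S" "x < y" "\<forall>a\<in>S. a \<le> x \<or> y \<le> a" "even (x + y)"
    | (wrap) "S \<noteq> {}" "odd (Min S + Max S)"
    | (regular) "S \<noteq> {}" "even (Min S + Max S)"
        "\<forall>x\<in>S. \<forall>y\<in>S. x < y \<longrightarrow> (\<forall>a\<in>S. a \<le> x \<or> y \<le> a) \<longrightarrow> odd (x + y)"
    by blast
  then show ?case
  proof cases
    case empty
    then show ?thesis by (auto simp: kernel_def)
  next
    case same
    obtain A where A: "kernel A (S - {x})" using remove same by blast
    then have "x \<notin> A" "\<forall>a\<in>A. a \<le> x \<or> y \<le> a"
      using same(4) by (auto simp: kernel_def)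
    moreover have "(-1 :: int) ^ x = (-1) ^ y"
      using same(5) by (auto simp: minus_one_power_iff)
    ultimately have "(-1) ^ y * score A y = (-1) ^ y * score A x - (if y \<in> A then (-1) ^ y else 0)"
      using score_step[of A x y] finA[OF A] same(3) by simp
    then have "score A x = score A y + (if y \<in> A then 1 else 0)"
      by (cases "even y") (auto split: if_splits)
    then show ?thesis using kernel_insert_dominated[OF A, of y] same by blast
  next
    case wrap
    define w z where "w = Min S" and "z = Max S"
    have wz: "w \<in> S" "z \<in> S" "w \<noteq> z" "S \<subseteq> {w..z}"
      using wrap \<open>finite S\<close> by (auto simp: w_def z_def)
    then have "w \<le> z" by auto
    obtain A where A: "kernel A (S - {z})" using remove wz by blast
    then have "z \<notin> A" "A \<subseteq> {w..z}" using wz(4) by (auto simp: kernel_def)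
    moreover have "(-1 :: int) ^ w = - ((-1) ^ z)"
      using wrap(2) by (auto simp: minus_one_power_iff w_def z_def)
    ultimately have "(-1) ^ z * score A z = (-1) ^ z * score A w + (if w \<in> A then (-1) ^ z else 0)"
      using score_wrap[of A w z] finA[OF A] \<open>w \<le> z\<close> by simp
    then have "score A z = score A w + (if w \<in> A then 1 else 0)"
      by (cases "even z") (auto split: if_splits)
    then show ?thesis using kernel_insert_dominated[OF A, of w] wz by blast
  next
    case regular
    define w z where "w = Min S" and "z = Max S"
    have wz: "w \<in> S" "z \<in> S" "S \<subseteq> {w..z}"
      using regular \<open>finite S\<close> by (auto simp: w_def z_def)
    then have "w \<le> z" by auto
    have const: "(-1) ^ x * score S x = (-1) ^ w * score S w" if "x \<in> S" for x
      using that
    proof (induction x rule: less_induct)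
      case (less x)
      show ?case
      proof (cases "x = w")
        case False
        then have "w < x" using wz less.prems by force
        then obtain y where y: "y \<in> S" "y < x" and gap: "\<forall>a\<in>S. a \<le> y \<or> x \<le> a"
          using predecessor_exists[OF \<open>finite S\<close> wz(1)] by blast
        then have "odd (y + x)" using regular(3) y less.prems by blast
        then have "(-1 :: int) ^ y = - ((-1) ^ x)" by (auto simp: minus_one_power_iff)
        then have "(-1) ^ x * score S x = (-1) ^ y * score S y"
          using score_step[of S y x] gap y less.prems \<open>finite S\<close> by auto
        then show ?thesis using less.IH y by simp
      qed simp
    qed
    have pow: "(-1 :: int) ^ w = (-1) ^ z"
      using regular(2) by (auto simp: minus_one_power_iff w_def z_def)
    have "(-1) ^ z * score S z = - ((-1) ^ w * score S w)"
      using score_wrap[of S w z] wz \<open>w \<le> z\<close> \<open>finite S\<close> pow by auto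
    then have "(-1) ^ w * score S w = 0" using const[OF wz(2)] by simp
    then have "score S x = 0" if "x \<in> S" for x using const[OF that] by simp
    then show ?thesis by (auto simp: kernel_def)
  qed
qed

definition kernel_top :: "nat \<Rightarrow> nat set \<Rightarrow> nat set" where
  "kernel_top k A = A \<union> {x \<in> {1..k}. 0 < score A x}"

lemma kernel_iff_between:
  assumes "\<forall>x\<in>A. score A x = 0" "S \<subseteq> {1..k}"
  shows "kernel A S \<longleftrightarrow> A \<subseteq> S \<and> S \<subseteq> kernel_top k A"
  using assms by (auto simp: kernel_def kernel_top_def)

text \<open>
  Within a gap of \<open>A\<close> the sign of the score alternates. Above \<open>Min A\<close> each gap starts with a
  positive score, so every point of negative score has a point of positive score as predecessor.
  Below \<open>Min A\<close> the last score is negative, and every point of negative score is followed by a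
  point of positive score or by \<open>Min A\<close> itself, which also belongs to the top. So sending a point \<open>x\<close> outside the top
  to \<open>x - 1\<close> above \<open>Min A\<close>, and to \<open>x + 1\<close> below it, maps the complement injectively into the top;
  the two kinds of images are separated by \<open>Min A\<close>.
\<close>

lemma card_kernel_top:
  assumes A: "A \<subseteq> {1..k}" "A \<noteq> {}" and reg: "\<forall>x\<in>A. score A x = 0"
  shows "k \<le> 2 * card (kernel_top k A)"
proof -
  have fin: "finite A" using A(1) finite_subset by blast
  define B where "B = kernel_top k A"
  have B: "finite B" "B \<subseteq> {1..k}"
    using A fin by (auto simp: B_def kernel_top_def)
  define w where "w = Min A"
  have w: "w \<in> A" "\<And>a. a \<in> A \<Longrightarrow> w \<le> a" using A(2) fin by (auto simp: w_def)
  \<comment> \<open>The sign of the score is given by the distance to the least element of \<open>A\<close>, or to the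
    closest element of \<open>A\<close> below.\<close>
  have below: "score A x = (-1) ^ (x + w)" if "x < w" for x
  proof -
    have "x \<notin> A" using w(2) that by force
    then have "(-1) ^ w * score A w = (-1) ^ x * score A x - (-1) ^ w"
      using score_step[of A x w] that w fin by auto
    then have "(-1) ^ x * score A x = (-1) ^ w" using reg w(1) by simp
    then have "(-1) ^ x * ((-1) ^ x * score A x) = (-1) ^ x * (-1) ^ w" by simp
    then show ?thesis by (simp add: power_add)
  qed
  have above: "score A x = - ((-1) ^ (x + a))" if "a \<in> A" "a < x" "x \<notin> A" "\<forall>b\<in>A. b \<le> a \<or> x \<le> b" for a x
  proof -
    have "(-1) ^ x * score A x = - ((-1) ^ a)"
      using score_step[of A a x] that reg fin by auto
    then have "(-1) ^ x * ((-1) ^ x * score A x) = - ((-1) ^ x * (-1) ^ a)" by simp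
    then show ?thesis by (simp add: power_add)
  qed
  define f where "f x = (if x < w then x + 1 else x - 1)" for x
  have side: "f x \<in> B \<and> (w < x \<longrightarrow> w < f x) \<and> x \<noteq> w" if x: "x \<in> {1..k} - B" for x
  proof -
    have x': "x \<notin> A" "\<not> 0 < score A x" "1 \<le> x" "x \<le> k" using x by (auto simp: B_def kernel_top_def)
    show ?thesis
    proof (cases "x < w")
      case True
      then have "odd (x + w)" using below[of x] x' by (auto simp: minus_one_power_iff split: if_splits)
      have "x + 1 \<in> B"
      proof (cases "x + 1 = w")
        case True
        then show ?thesis using w by (simp add: B_def kernel_top_def)
      next
        case False
        then have "x + 1 < w" using True by simp
        then have "0 < score A (x + 1)"
          using below[of "x + 1"] \<open>odd (x + w)\<close> by (auto simp: minus_one_power_iff)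
        moreover have "w \<le> k" using w A by auto
        ultimately show ?thesis using \<open>x + 1 < w\<close> by (auto simp: B_def kernel_top_def)
      qed
      then show ?thesis using True by (simp add: f_def)
    next
      case False
      then have "w < x" using x'(1) w(1) by (cases "w = x") auto
      then obtain a where a: "a \<in> A" "a < x" and gap: "\<forall>b\<in>A. b \<le> a \<or> x \<le> b"
        using predecessor_exists[OF fin w(1)] by blast
      have "even (x + a)"
        using above[OF a x'(1) gap] x' by (auto simp: minus_one_power_iff split: if_splits)
      then have "a < x - 1" using a by (cases "x = a + 1") auto
      then have notA: "x - 1 \<notin> A" using gap by force
      have gap': "\<forall>b\<in>A. b \<le> a \<or> x - 1 \<le> b" using gap by force
      have "odd (x - 1 + a)" using \<open>even (x + a)\<close> a by (cases x) auto
      then have "0 < score A (x - 1)"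
        using above[OF a(1) \<open>a < x - 1\<close> notA gap'] by (auto simp: minus_one_power_iff)
      then have "x - 1 \<in> B" using \<open>a < x - 1\<close> x' by (auto simp: B_def kernel_top_def)
      then show ?thesis using False \<open>a < x - 1\<close> w(2)[OF a(1)] \<open>w < x\<close> by (simp add: f_def)
    qed
  qed
  have "inj_on f ({1..k} - B)"
  proof (rule inj_onI)
    fix x y assume xy: "x \<in> {1..k} - B" "y \<in> {1..k} - B" "f x = f y"
    then show "x = y"
      using side[OF xy(1)] side[OF xy(2)] unfolding f_def by (auto split: if_splits)
  qed
  moreover have "f ` ({1..k} - B) \<subseteq> B" using side by blast
  ultimately have "card ({1..k} - B) \<le> card B" using B(1) by (intro card_inj_on_le)
  moreover have "card ({1..k} - B) = k - card B" using B by (simp add: card_Diff_subset)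
  ultimately show ?thesis unfolding B_def by simp
qed

section \<open>Tuples over a chain\<close>

definition nonzero_tuples :: "nat \<Rightarrow> nat \<Rightarrow> (nat \<Rightarrow> nat) set" where
  "nonzero_tuples n k = chain_power n k - {zero_tuple k}"

definition supp :: "nat \<Rightarrow> (nat \<Rightarrow> nat) \<Rightarrow> nat set" where
  "supp k z = {j \<in> {1..k}. 0 < z j}"

definition flat :: "nat \<Rightarrow> nat set \<Rightarrow> nat \<Rightarrow> nat \<Rightarrow> nat" where
  "flat k A c = (\<lambda>j\<in>{1..k}. if j \<in> A then c else 0)"

lemma nonzero_tuples_iff:
  "z \<in> nonzero_tuples n k \<longleftrightarrow>
    z \<in> extensional {1..k} \<and> (\<forall>j\<in>{1..k}. z j < n) \<and> supp k z \<noteq> {}"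
proof -
  have "z = zero_tuple k \<longleftrightarrow> supp k z = {}" if "z \<in> extensional {1..k}"
  proof
    assume "supp k z = {}"
    then show "z = zero_tuple k"
      using that by (intro extensionalityI[of _ "{1..k}"]) (auto simp: zero_tuple_def supp_def)
  qed (simp add: zero_tuple_def supp_def)
  then show ?thesis by (auto simp: nonzero_tuples_def chain_power_def PiE_iff)
qed

lemma finite_nonzero_tuples: "finite (nonzero_tuples n k)"
  by (simp add: nonzero_tuples_def chain_power_def finite_PiE)

lemma tuple_le_antisym:
  assumes "x \<in> nonzero_tuples n k" "y \<in> nonzero_tuples n k" "tuple_le k x y" "tuple_le k y x"
  shows "x = y"
  using assms unfolding nonzero_tuples_iff tuple_le_def
  by (intro extensionalityI[of _ "{1..k}"]) (auto intro: le_antisym)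

lemma supp_flat: "\<lbrakk>A \<subseteq> {1..k}; 0 < c\<rbrakk> \<Longrightarrow> supp k (flat k A c) = A"
  by (auto simp: supp_def flat_def)

lemma flat_nonzero:
  assumes "A \<subseteq> {1..k}" "A \<noteq> {}" "0 < c" "c < n"
  shows "flat k A c \<in> nonzero_tuples n k"
  using assms supp_flat[of A k c] by (simp add: nonzero_tuples_iff flat_def)

text \<open>
  Whether a lower bound with entries \<open>0\<close> and \<open>1\<close> or an upper bound with entries \<open>0\<close> and \<open>n - 1\<close>
  is respected depends on the support only; this turns intervals of sets into intervals of tuples.
\<close>

lemma between_flat_iff:
  assumes "z \<in> nonzero_tuples n k" "A \<subseteq> {1..k}" "B \<subseteq> {1..k}"
  shows "tuple_le k (flat k A 1) z \<and> tuple_le k z (flat k B (n - 1)) \<longleftrightarrow> A \<subseteq> supp k z \<and> supp k z \<subseteq> B"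
proof -
  have lt: "z j < n" if "j \<in> {1..k}" for j using assms that nonzero_tuples_iff by blast
  have "tuple_le k (flat k A 1) z \<longleftrightarrow> A \<subseteq> supp k z"
    using assms(2) by (force simp: tuple_le_def flat_def supp_def)
  moreover have "tuple_le k z (flat k B (n - 1)) \<longleftrightarrow> supp k z \<subseteq> B"
    using lt by (force simp: tuple_le_def flat_def supp_def)
  ultimately show ?thesis by simp
qed

lemma sum_flat:
  assumes "A \<subseteq> {1..k}"
  shows "(\<Sum>j\<in>{1..k}. flat k A c j) = c * card A"
proof -
  have "(\<Sum>j\<in>{1..k}. flat k A c j) = (\<Sum>j\<in>{1..k}. if j \<in> A then c else 0)"
    by (rule sum.cong) (simp_all add: flat_def)
  also have "\<dots> = (\<Sum>j\<in>{1..k} \<inter> A. c)" by (rule sum.inter_restrict[symmetric]) simp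
  also have "{1..k} \<inter> A = A" using assms by blast
  finally show ?thesis by simp
qed

lemma height_nonzero_tuples:
  assumes "Z \<in> nonzero_tuples n k"
  shows "height (nonzero_tuples n k) (tuple_le k) Z = (\<Sum>j\<in>{1..k}. Z j)"
proof (rule height_eq_rank[OF _ _ _ _ assms])
  fix x y assume xy: "x \<in> nonzero_tuples n k" "y \<in> nonzero_tuples n k" "tuple_le k y x" "y \<noteq> x"
  then have "\<not> tuple_le k x y" using tuple_le_antisym by blast
  then show "(\<Sum>j\<in>{1..k}. y j) < (\<Sum>j\<in>{1..k}. x j)"
    using xy(3) by (intro sum_strict_mono_ex1) (auto simp: tuple_le_def not_le)
next
  fix x assume "x \<in> nonzero_tuples n k"
  then obtain j where "j \<in> {1..k}" "0 < x j" by (auto simp: nonzero_tuples_iff supp_def)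
  then show "0 < (\<Sum>j\<in>{1..k}. x j)" by (intro sum_pos2[of _ j]) auto
next
  fix x assume x: "x \<in> nonzero_tuples n k" and "1 < (\<Sum>j\<in>{1..k}. x j)"
  obtain i where i: "i \<in> {1..k}" "0 < x i" using x by (auto simp: nonzero_tuples_iff supp_def)
  define y where "y = x(i := x i - 1)"
  have "(\<Sum>j\<in>{1..k} - {i}. y j) = (\<Sum>j\<in>{1..k} - {i}. x j)"
    by (rule sum.cong) (auto simp: y_def)
  then have sum: "Suc (\<Sum>j\<in>{1..k}. y j) = (\<Sum>j\<in>{1..k}. x j)"
    using sum.remove[of "{1..k}" i y] sum.remove[of "{1..k}" i x] i by (simp add: y_def)
  then have "(\<Sum>j\<in>{1..k}. y j) \<noteq> 0" using \<open>1 < (\<Sum>j\<in>{1..k}. x j)\<close> by linarith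
  then have "supp k y \<noteq> {}" by (auto simp: supp_def)
  moreover have "y \<in> extensional {1..k}"
    using x i by (auto simp: nonzero_tuples_iff y_def extensional_def)
  moreover have "\<forall>j\<in>{1..k}. y j < n"
    using x by (auto simp: nonzero_tuples_iff y_def intro: le_less_trans[OF diff_le_self])
  ultimately have "y \<in> nonzero_tuples n k" unfolding nonzero_tuples_iff by blast
  moreover have "tuple_le k y x" by (simp add: tuple_le_def y_def)
  moreover have "y \<noteq> x" using sum by auto
  ultimately show "\<exists>y\<in>nonzero_tuples n k. tuple_le k y x \<and> y \<noteq> x
      \<and> Suc (\<Sum>j\<in>{1..k}. y j) = (\<Sum>j\<in>{1..k}. x j)"
    using sum by blast
next
  fix x y z assume "tuple_le k x y" "tuple_le k y z"
  then show "tuple_le k x z" unfolding tuple_le_def using le_trans by blast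
qed

text \<open>
  The sets \<open>N i\<close> are the out-neighbourhoods, possibly with loops, of an antisymmetric relation on \<open>V\<close>.
  Summing their sizes twice counts each ordered pair of distinct elements at most once and each
  loop at most twice, so twice the average size is at most \<open>card V + 1\<close>.
\<close>

lemma exists_small_out_neighbourhood:
  assumes fin: "finite V" "V \<noteq> {}" and sub: "\<And>i. i \<in> V \<Longrightarrow> N i \<subseteq> V"
    and asym: "\<And>i j. \<lbrakk>i \<in> V; j \<in> V; i \<noteq> j; j \<in> N i\<rbrakk> \<Longrightarrow> i \<notin> N j"
  shows "\<exists>i\<in>V. 2 * card (N i) \<le> card V + 1"
proof (rule ccontr)
  assume "\<not> ?thesis"
  then have big: "card V + 2 \<le> 2 * card (N i)" if "i \<in> V" for i using that by force
  have card: "card (N i) = (\<Sum>j\<in>V. of_bool (j \<in> N i))" if "i \<in> V" for i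
    using fin sub[OF that] by (simp add: Int_absorb1)
  have "card V * (card V + 2) = (\<Sum>i\<in>V. card V + 2)" by simp
  also have "\<dots> \<le> (\<Sum>i\<in>V. 2 * card (N i))" by (intro sum_mono big)
  also have "\<dots> = (\<Sum>i\<in>V. \<Sum>j\<in>V. of_bool (j \<in> N i)) + (\<Sum>i\<in>V. \<Sum>j\<in>V. of_bool (j \<in> N i))"
    by (simp add: card mult_2 sum.distrib)
  also have "(\<Sum>i\<in>V. \<Sum>j\<in>V. of_bool (j \<in> N i)) = (\<Sum>i\<in>V. \<Sum>j\<in>V. of_bool (i \<in> N j) :: nat)"
    by (rule sum.swap)
  also have "(\<Sum>i\<in>V. \<Sum>j\<in>V. of_bool (i \<in> N j)) + (\<Sum>i\<in>V. \<Sum>j\<in>V. of_bool (i \<in> N j))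
      = (\<Sum>i\<in>V. \<Sum>j\<in>V. of_bool (i \<in> N j)) + (\<Sum>i\<in>V. \<Sum>j\<in>V. of_bool (j \<in> N i) :: nat)"
    by (intro arg_cong2[of _ _ _ _ "(+)"] refl sum.swap)
  also have "\<dots> = (\<Sum>i\<in>V. \<Sum>j\<in>V. of_bool (i \<in> N j) + of_bool (j \<in> N i))"
    by (simp add: sum.distrib)
  also have "\<dots> \<le> (\<Sum>i\<in>V. \<Sum>j\<in>V. 1 + (if i = j then 1 else 0))"
    by (intro sum_mono) (use asym in auto)
  also have "\<dots> = (\<Sum>i\<in>V. card V + 1)"
    by (intro sum.cong refl, subst sum.distrib) (use fin in simp)
  also have "\<dots> = card V * (card V + 1)" by simp
  finally show False using fin by simp
qed

text \<open>
  The out-neighbourhood of \<open>i\<close> is the support of the top of the interval whose bottom is the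
  \<open>i\<close>-th atom. Two distinct atoms cannot lie in each other's neighbourhoods, as their join would
  belong to both intervals.
\<close>

lemma top_of_small_height_exists:
  assumes n: "2 \<le> n" and k: "1 \<le> k"
    and part: "interval_partition (nonzero_tuples n k) (tuple_le k) \<pi>"
  shows "\<exists>X\<in>nonzero_tuples n k. \<exists>Y\<in>nonzero_tuples n k. tuple_le k X Y
    \<and> interval_in (nonzero_tuples n k) (tuple_le k) X Y \<in> \<pi>
    \<and> height (nonzero_tuples n k) (tuple_le k) Y \<le> (n - 1) * ((k + 1) div 2)"
proof -
  let ?P = "nonzero_tuples n k"
  define atom where "atom i = flat k {i} 1" for i
  have atom: "atom i \<in> ?P" if "i \<in> {1..k}" for i
    unfolding atom_def using that n by (intro flat_nonzero) auto
  have on: "partition_on ?P \<pi>" using part by (simp add: interval_partition_def)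
  have "\<exists>Y. Y \<in> ?P \<and> tuple_le k (atom i) Y \<and> interval_in ?P (tuple_le k) (atom i) Y \<in> \<pi>"
    if i: "i \<in> {1..k}" for i
  proof -
    obtain I where I: "I \<in> \<pi>" "atom i \<in> I" using on atom[OF i] by (auto simp: partition_on_def)
    then obtain X Y where XY: "X \<in> ?P" "Y \<in> ?P" "I = interval_in ?P (tuple_le k) X Y"
      using part by (auto simp: interval_partition_def)
    then have le: "tuple_le k X (atom i)" "tuple_le k (atom i) Y" using I(2) by (auto simp: interval_in_def)
    \<comment> \<open>An atom is minimal, so it is the bottom of the interval that contains it.\<close>
    have X0: "X j = 0" if "j \<in> {1..k}" "j \<noteq> i" for j
      using le(1) that by (force simp: tuple_le_def atom_def flat_def)
    obtain j where "j \<in> {1..k}" "0 < X j" using XY(1) unfolding nonzero_tuples_iff supp_def by blast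
    then have "0 < X i" using X0 by (cases "j = i") auto
    then have "tuple_le k (atom i) X" by (auto simp: tuple_le_def atom_def flat_def)
    then have "X = atom i" using tuple_le_antisym[OF XY(1) atom[OF i]] le by blast
    then show ?thesis using XY I le by blast
  qed
  then obtain top where top: "\<And>i. i \<in> {1..k} \<Longrightarrow> top i \<in> ?P \<and> tuple_le k (atom i) (top i)
      \<and> interval_in ?P (tuple_le k) (atom i) (top i) \<in> \<pi>" by metis
  have asym: "i \<notin> supp k (top j)"
    if ij: "i \<in> {1..k}" "j \<in> {1..k}" "i \<noteq> j" "j \<in> supp k (top i)" for i j
  proof
    assume "i \<in> supp k (top j)"
    let ?I = "\<lambda>i. interval_in ?P (tuple_le k) (atom i) (top i)"
    have self: "i \<in> supp k (top i)" if "i \<in> {1..k}" for i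
    proof -
      have "atom i i \<le> top i i" using top[OF that] that unfolding tuple_le_def by blast
      then show ?thesis using that by (simp add: atom_def flat_def supp_def)
    qed
    have pair: "flat k {i, j} 1 \<in> ?P" using ij(1,2) n by (intro flat_nonzero) auto
    have "flat k {i, j} 1 \<in> ?I i" "flat k {i, j} 1 \<in> ?I j"
      using ij \<open>i \<in> supp k (top j)\<close> self[OF ij(1)] self[OF ij(2)] pair
      by (auto simp: interval_in_def tuple_le_def atom_def flat_def supp_def Suc_le_eq)
    then have "?I i = ?I j"
      using partition_onD2[OF on] top[OF ij(1)] top[OF ij(2)] by (auto simp: disjoint_def)
    moreover have "atom i \<in> ?I i" using top[OF ij(1)] atom[OF ij(1)] by (simp add: interval_in_def tuple_le_def)
    ultimately have "tuple_le k (atom j) (atom i)" by (auto simp: interval_in_def)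
    then show False using ij by (force simp: tuple_le_def atom_def flat_def)
  qed
  have "\<exists>i\<in>{1..k}. 2 * card (supp k (top i)) \<le> card {1..k} + 1"
  proof (rule exists_small_out_neighbourhood)
    show "{1..k} \<noteq> {}" using k by simp
    show "supp k (top i) \<subseteq> {1..k}" for i by (auto simp: supp_def)
  qed (use asym in blast)+
  then obtain i where i: "i \<in> {1..k}" "2 * card (supp k (top i)) \<le> k + 1" by auto
  have "(\<Sum>j\<in>{1..k}. top i j) = (\<Sum>j\<in>supp k (top i). top i j)"
    by (rule sum.mono_neutral_right) (auto simp: supp_def)
  also have "\<dots> \<le> (\<Sum>j\<in>supp k (top i). n - 1)"
  proof (rule sum_mono)
    fix j assume "j \<in> supp k (top i)"
    then have "top i j < n" using top[OF i(1)] unfolding nonzero_tuples_iff supp_def by blast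
    then show "top i j \<le> n - 1" by simp
  qed
  also have "\<dots> = (n - 1) * card (supp k (top i))" by simp
  also have "\<dots> \<le> (n - 1) * ((k + 1) div 2)" using i(2) by (intro mult_le_mono2) linarith
  finally show ?thesis
    using top[OF i(1)] atom[OF i(1)] height_nonzero_tuples by fastforce
qed

lemma tdepth_nonzero_tuples:
  assumes n: "2 \<le> n" and k: "1 \<le> k"
  shows "tdepth (nonzero_tuples n k) (tuple_le k) = (n - 1) * ((k + 1) div 2)"
proof -
  let ?P = "nonzero_tuples n k"
  define K where "K = {A. A \<subseteq> {1..k} \<and> A \<noteq> {} \<and> (\<forall>x\<in>A. score A x = 0)}"
  define bot where "bot A = flat k A 1" for A
  define top where "top A = flat k (kernel_top k A) (n - 1)" for A
  define E where "E = (\<lambda>A. (bot A, top A)) ` K"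
  have K: "A \<subseteq> {1..k}" "A \<noteq> {}" "\<forall>x\<in>A. score A x = 0" "kernel_top k A \<subseteq> {1..k}" "A \<subseteq> kernel_top k A"
    if "A \<in> K" for A
    using that by (auto simp: K_def kernel_top_def)
  have bot: "bot A \<in> ?P" and top: "top A \<in> ?P" if "A \<in> K" for A
    unfolding bot_def top_def using K[OF that] n by (intro flat_nonzero; auto)+
  have ends: "bot A \<in> ?P \<and> top A \<in> ?P \<and> tuple_le k (bot A) (top A)" if "A \<in> K" for A
    using bot[OF that] top[OF that] K(5)[OF that] n
    by (auto simp: bot_def top_def tuple_le_def flat_def)
  have between: "tuple_le k (bot A) Z \<and> tuple_le k Z (top A) \<longleftrightarrow> kernel A (supp k Z)"
    if A: "A \<in> K" and Z: "Z \<in> ?P" for A Z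
  proof -
    have "supp k Z \<subseteq> {1..k}" by (auto simp: supp_def)
    then show ?thesis
      unfolding bot_def top_def between_flat_iff[OF Z K(1)[OF A] K(4)[OF A]]
      by (rule kernel_iff_between[OF K(3)[OF A], symmetric])
  qed
  have fin: "finite (supp k Z)" for Z by (simp add: supp_def)
  have part: "interval_partition ?P (tuple_le k) ((\<lambda>(X, Y). interval_in ?P (tuple_le k) X Y) ` E)"
  proof (rule interval_partitionI)
    show "tuple_le k x x" for x by (simp add: tuple_le_def)
    show "X \<in> ?P \<and> Y \<in> ?P \<and> tuple_le k X Y" if "(X, Y) \<in> E" for X Y
      using that ends unfolding E_def by blast
  next
    fix Z assume Z: "Z \<in> ?P"
    obtain A where A: "kernel A (supp k Z)" using kernel_exists[OF fin] by blast
    have "supp k Z \<noteq> {}" using Z unfolding nonzero_tuples_iff by blast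
    then have "A \<noteq> {}" using A by (auto simp: kernel_def score_def)
    then have "A \<in> K" using A by (auto simp: K_def kernel_def supp_def)
    then show "\<exists>X Y. (X, Y) \<in> E \<and> tuple_le k X Z \<and> tuple_le k Z Y"
      using between[OF _ Z] A unfolding E_def by blast
  next
    fix Z X Y X' Y'
    assume Z: "Z \<in> ?P" and XY: "(X, Y) \<in> E" "tuple_le k X Z" "tuple_le k Z Y"
      and XY': "(X', Y') \<in> E" "tuple_le k X' Z" "tuple_le k Z Y'"
    obtain A where A: "A \<in> K" "X = bot A" "Y = top A" using XY(1) by (auto simp: E_def)
    obtain A' where A': "A' \<in> K" "X' = bot A'" "Y' = top A'" using XY'(1) by (auto simp: E_def)
    \<comment> \<open>Both \<open>A\<close> and \<open>A'\<close> are kernels of the support of \<open>Z\<close>.\<close>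
    have "A = A'"
      using kernel_unique[OF fin] between[OF A(1) Z] between[OF A'(1) Z] XY XY' A A' by blast
    then show "X = X' \<and> Y = Y'" using A A' by simp
  qed
  show ?thesis
  proof (rule tdepth_eqI[OF finite_nonzero_tuples part])
    fix X Y assume X: "X \<in> ?P" and Y: "Y \<in> ?P" and le: "tuple_le k X Y"
      and mem: "interval_in ?P (tuple_le k) X Y \<in> (\<lambda>(X, Y). interval_in ?P (tuple_le k) X Y) ` E"
    obtain A where A: "A \<in> K"
      and eq: "interval_in ?P (tuple_le k) X Y = interval_in ?P (tuple_le k) (bot A) (top A)"
      using mem by (auto simp: E_def)
    \<comment> \<open>An interval determines its top, so \<open>Y\<close> is the top that was chosen for \<open>A\<close>.\<close>
    have "Y \<in> interval_in ?P (tuple_le k) X Y"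
      using Y le by (simp add: interval_in_def tuple_le_def)
    then have "tuple_le k Y (top A)" unfolding eq by (simp add: interval_in_def)
    moreover have "top A \<in> interval_in ?P (tuple_le k) (bot A) (top A)"
      using ends[OF A] by (simp add: interval_in_def tuple_le_def)
    then have "tuple_le k (top A) Y" unfolding eq[symmetric] by (simp add: interval_in_def)
    ultimately have "Y = top A" using tuple_le_antisym[OF Y top[OF A]] by blast
    then have "height ?P (tuple_le k) Y = (n - 1) * card (kernel_top k A)"
      using height_nonzero_tuples[OF Y] sum_flat[OF K(4)[OF A]] by (simp add: top_def)
    moreover have "(k + 1) div 2 \<le> card (kernel_top k A)"
      using card_kernel_top[OF K(1-3)[OF A]] by linarith
    ultimately show "(n - 1) * ((k + 1) div 2) \<le> height ?P (tuple_le k) Y" by simp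
  next
    fix \<pi> assume "interval_partition ?P (tuple_le k) \<pi>"
    then show "\<exists>X\<in>?P. \<exists>Y\<in>?P. tuple_le k X Y \<and> interval_in ?P (tuple_le k) X Y \<in> \<pi>
      \<and> height ?P (tuple_le k) Y \<le> (n - 1) * ((k + 1) div 2)"
      by (rule top_of_small_height_exists[OF n k])
  qed
qed

section \<open>Submultisets as tuples\<close>

lemma count_sum_replicate_mset:
  fixes i k :: nat
  shows "count (\<Sum>j\<in>{1..k}. replicate_mset (f j) j) i = (if i \<in> {1..k} then f i else 0)"
proof -
  have "count (\<Sum>j\<in>{1..k}. replicate_mset (f j) j) i = (\<Sum>j\<in>{1..k}. if i = j then f j else 0)"
    unfolding count_sum by (intro sum.cong) auto
  then show ?thesis by simp
qed

lemma nonempty_submultisets_iff: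
  "A \<in> nonempty_submultisets k m \<longleftrightarrow>
    A \<noteq> {#} \<and> (\<forall>j. count A j \<le> (if j \<in> {1..k} then m j else 0))"
  unfolding nonempty_submultisets_def subseteq_mset_def count_sum_replicate_mset by simp

lemma multiplicities_order_iso:
  assumes "1 \<le> n"
  shows "order_iso (\<lambda>A. \<lambda>j\<in>{1..k}. count A j)
    (nonempty_submultisets k (\<lambda>_. n - 1)) (\<subseteq>#) (nonzero_tuples n k) (tuple_le k)"
proof -
  let ?M = "nonempty_submultisets k (\<lambda>_. n - 1)"
  let ?f = "\<lambda>A. \<lambda>j\<in>{1..k}. count A j"
  have outside: "count A j = 0" if "A \<in> ?M" "j \<notin> {1..k}" for A j
    using that unfolding nonempty_submultisets_iff by (metis le_zero_eq)
  have order: "tuple_le k (?f A) (?f B) \<longleftrightarrow> A \<subseteq># B" if "A \<in> ?M" for A B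
  proof -
    have "tuple_le k (?f A) (?f B) \<longleftrightarrow> (\<forall>j\<in>{1..k}. count A j \<le> count B j)"
      by (simp add: tuple_le_def)
    also have "\<dots> \<longleftrightarrow> (\<forall>j. count A j \<le> count B j)" using outside[OF that] by (metis zero_le)
    finally show ?thesis by (simp add: subseteq_mset_def)
  qed
  have inj: "inj_on ?f ?M"
  proof (rule inj_onI)
    fix A B assume AB: "A \<in> ?M" "B \<in> ?M" "?f A = ?f B"
    have "tuple_le k (?f A) (?f B)" "tuple_le k (?f B) (?f A)"
      unfolding AB(3) by (simp_all add: tuple_le_def)
    then show "A = B" using order[OF AB(1)] order[OF AB(2)] by (simp add: subset_mset.antisym)
  qed
  have "?f A \<in> nonzero_tuples n k" if A: "A \<in> ?M" for A
  proof -
    have "A \<noteq> {#}" using A by (simp add: nonempty_submultisets_iff)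
    then obtain j where "0 < count A j" by (auto simp: multiset_eq_iff)
    moreover have "j \<in> {1..k}" using outside[OF A, of j] calculation by force
    ultimately have "supp k (?f A) \<noteq> {}" by (auto simp: supp_def)
    moreover have "?f A j < n" if "j \<in> {1..k}" for j
    proof -
      have "count A j \<le> n - 1" using A that unfolding nonempty_submultisets_iff by metis
      then show ?thesis using that assms by simp
    qed
    ultimately show ?thesis unfolding nonzero_tuples_iff by simp
  qed
  moreover have "z \<in> ?f ` ?M" if z: "z \<in> nonzero_tuples n k" for z
  proof
    let ?A = "\<Sum>j\<in>{1..k}. replicate_mset (z j) j"
    have ext: "z \<in> extensional {1..k}" and lt: "\<And>j. j \<in> {1..k} \<Longrightarrow> z j < n" and "supp k z \<noteq> {}"
      using z unfolding nonzero_tuples_iff by blast+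
    show "z = ?f ?A"
    proof (rule extensionalityI[OF ext])
      show "z j = ?f ?A j" if "j \<in> {1..k}" for j
        using that by (simp only: count_sum_replicate_mset restrict_apply if_True)
    qed simp
    obtain j where "j \<in> {1..k}" "0 < z j" using \<open>supp k z \<noteq> {}\<close> by (auto simp: supp_def)
    then have "count ?A j \<noteq> 0" unfolding count_sum_replicate_mset by simp
    then have "?A \<noteq> {#}" by (metis count_empty)
    moreover have "count ?A j \<le> (if j \<in> {1..k} then n - 1 else 0)" for j
      unfolding count_sum_replicate_mset using lt[of j] by auto
    ultimately show "?A \<in> ?M" unfolding nonempty_submultisets_iff by blast
  qed
  ultimately have "bij_betw ?f ?M (nonzero_tuples n k)"
    using inj unfolding bij_betw_def by blast
  then show ?thesis using order by (simp add: order_iso_def)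
qed

lemma nat_ceiling_half: "nat \<lceil>real k / 2\<rceil> = (k + 1) div 2"
proof -
  have "\<lceil>real k / 2\<rceil> = int ((k + 1) div 2)"
    by (rule ceiling_unique) linarith+
  then show ?thesis by simp
qed

theorem corollary5p3:
  fixes n k :: nat
  assumes "n \<ge> 2" and "k \<ge> 1"
  shows "tdepth (chain_power n k - {zero_tuple k}) (tuple_le k)
           = tdepth (nonempty_submultisets k (\<lambda>_. n - 1)) (\<subseteq>#)
       \<and> tdepth (nonempty_submultisets k (\<lambda>_. n - 1)) (\<subseteq>#) = (n - 1) * nat \<lceil>real k / 2\<rceil>"
  using tdepth_order_iso[OF multiplicities_order_iso, of n k] tdepth_nonzero_tuples[OF assms] assms(1)
  by (simp add: nat_ceiling_half nonzero_tuples_def)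

end
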